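(* For all real $a,b$, $$\frac{2}{\pi}\int_0^\infty \int_0^\infty\frac{\cos ax\,\cos by}{\cosh\sqrt{\pi}x+\cosh\sqrt{\pi}y}\,dx\,dy=\frac{1}{\cosh\sqrt{\pi}a+\cosh\sqrt{\pi}b}.$$
   Context: Here $\cosh\sqrt{\pi}x$ means $\cosh(\sqrt{\pi}\,x)$, and similarly for the other terms. *)

theory Defs
  imports "HOL-Analysis.Analysis"
begin

end

theory Submission
  imports Defs
begin

text \<open>Since \<open>cosh u + cosh v = 2 cosh ((u + v) / 2) cosh ((u - v) / 2)\<close>, the integral over the
  whole plane, with exponentials in place of cosines, factors into two Fourier transforms of the
  hyperbolic secant, taken at \<open>a + b\<close> and \<open>a - b\<close>. These are again hyperbolic secants, by Euler's
  reflection formula. Evenness folds the plane onto the quadrant.\<close>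

section \<open>Correlation integrals on the line\<close>

text \<open>Lebesgue measure is translation invariant, so for each fixed \<open>x\<close> the
  integral of the norm over \<open>y\<close> is the norm of \<open>f x\<close> times a constant, the
  L1 norm of \<open>g\<close>; this is integrable in \<open>x\<close>.\<close>

lemma integrable_shear_product:
  fixes f g :: "real \<Rightarrow> complex"
  assumes f: "integrable lborel f" and g: "integrable lborel g"
  shows "integrable (lborel \<Otimes>\<^sub>M lborel) (\<lambda>(x, y). f x * g (y + x))"
proof (rule lborel_pair.Fubini_integrable)
  have [measurable]: "f \<in> borel_measurable borel" "g \<in> borel_measurable borel"
    using f g by auto
  show "(\<lambda>(x, y). f x * g (y + x)) \<in> borel_measurable (lborel \<Otimes>\<^sub>M lborel)"
    by measurable
  have shift: "integrable lborel (\<lambda>y. g (y + x))" for x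
    using lborel_integrable_real_affine[OF g, of 1 x] by (simp add: add.commute)
  show "AE x in lborel. integrable lborel (\<lambda>y. case (x, y) of (x, y) \<Rightarrow> f x * g (y + x))"
    using shift by simp
  have "(\<integral>y. norm (g (y + x)) \<partial>lborel) = (\<integral>y. norm (g y) \<partial>lborel)" for x
    using lborel_integral_real_affine[of 1 "\<lambda>y. norm (g y)" x] by (simp add: add.commute)
  then show "integrable lborel
      (\<lambda>x. \<integral>y. norm (case (x, y) of (x, y) \<Rightarrow> f x * g (y + x)) \<partial>lborel)"
    using f by (simp add: norm_mult)
qed

text \<open>After Fubini the integral over \<open>y\<close> comes first and, by translation
  invariance, does not depend on \<open>x\<close>. Used twice: for a product of two Gamma integrals
  and for a product of two hyperbolic secant transforms.\<close>

lemma has_bochner_integral_convolution: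
  fixes f g :: "real \<Rightarrow> complex"
  assumes f: "integrable lborel f" and g: "integrable lborel g"
  shows "has_bochner_integral lborel (\<lambda>y. \<integral>x. f x * g (y + x) \<partial>lborel)
    ((\<integral>x. f x \<partial>lborel) * (\<integral>y. g y \<partial>lborel))"
proof -
  note prod = integrable_shear_product[OF f g]
  have "(\<integral>y. g (y + x) \<partial>lborel) = (\<integral>y. g y \<partial>lborel)" for x
    using lborel_integral_real_affine[of 1 g x] by (simp add: add.commute)
  then have "(\<integral>y. (\<integral>x. f x * g (y + x) \<partial>lborel) \<partial>lborel)
      = (\<integral>x. f x \<partial>lborel) * (\<integral>y. g y \<partial>lborel)"
    using lborel_pair.Fubini_integral[OF prod] by simp
  then show ?thesis
    using lborel_pair.integrable_snd[OF prod] by (simp add: has_bochner_integral_iff)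
qed

section \<open>The Gamma function and the reflection formula\<close>

text \<open>Euler's integral after the substitution \<open>t = exp s\<close>, whose Jacobian raises
  the exponent \<open>z - 1\<close> to \<open>z\<close>. Quotients of the old variables become
  differences of the new ones, which fits the correlation lemma.\<close>

lemma has_bochner_integral_Gamma_exp:
  fixes z :: complex
  assumes "Re z > 0"
  shows "has_bochner_integral lborel (\<lambda>s::real. exp (z * of_real s - of_real (exp s))) (Gamma z)"
proof -
  define f :: "real \<Rightarrow> complex" where "f t = of_real t powr (z - 1) / of_real (exp t)" for t
  have range: "range exp = {0::real<..}"
    by (auto simp: image_iff) (metis exp_ln)
  have f: "f absolutely_integrable_on range exp" "integral (range exp) f = Gamma z"
    using absolutely_integrable_Gamma_integral'[OF assms] Gamma_integral_complex'[OF assms]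
    unfolding range f_def[abs_def] by (auto simp: integral_unique)
  have eq: "\<bar>exp s\<bar> *\<^sub>R f (exp s) = exp (z * of_real s - of_real (exp s))" for s
  proof -
    have "\<bar>exp s\<bar> *\<^sub>R f (exp s) = exp (of_real s) * (exp ((z - 1) * of_real s) / exp (of_real (exp s)))"
      unfolding f_def scaleR_conv_of_real
      by (simp add: powr_def exp_of_real[symmetric] Ln_of_real)
    also have "\<dots> = exp (z * of_real s - of_real (exp s))"
      by (simp add: exp_diff exp_add algebra_simps)
    finally show ?thesis .
  qed
  have "(\<lambda>s. \<bar>exp s\<bar> *\<^sub>R f (exp s)) absolutely_integrable_on UNIV \<and>
      integral UNIV (\<lambda>s. \<bar>exp s\<bar> *\<^sub>R f (exp s)) = Gamma z"
    using f by (subst has_absolute_integral_change_of_variables_real)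
      (auto intro!: derivative_eq_intros DERIV_exp inj_onI)
  then have abs: "integrable lebesgue (\<lambda>s::real. exp (z * of_real s - of_real (exp s)))"
    and int: "integral UNIV (\<lambda>s::real. exp (z * of_real s - of_real (exp s))) = Gamma z"
    unfolding eq set_integrable_def by simp_all
  \<comment> \<open>The change of variables takes place over the completed measure
    \<open>lebesgue\<close>; Borel measurability of the integrand carries integrability back to
    \<open>lborel\<close>.\<close>
  have meas: "(\<lambda>s::real. exp (z * of_real s - of_real (exp s))) \<in> borel_measurable lborel"
    by simp
  have "integrable lborel (\<lambda>s::real. exp (z * of_real s - of_real (exp s)))"
    using abs meas by (simp add: integrable_completion)
  then show ?thesis
    using int integral_lborel by (fastforce simp: has_bochner_integral_iff)
qed

text \<open>Translating by \<open>ln c\<close> turns \<open>exp s\<close> into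
  \<open>c * exp s\<close>, so this reduces to \<open>Gamma 1 = 1\<close>; the same translation
  multiplies the first exponential by \<open>c\<close>.\<close>

lemma has_bochner_integral_exp_minus_exp:
  fixes c :: real
  assumes "c > 0"
  shows "has_bochner_integral lborel (\<lambda>s::real. exp (of_real s - of_real (c * exp s))) (1 / of_real c :: complex)"
proof -
  have "has_bochner_integral lborel
      (\<lambda>s::real. exp (of_real (ln c + 1 * s) - of_real (exp (ln c + 1 * s)))) (1 :: complex)"
    using has_bochner_integral_Gamma_exp[of 1]
    by (subst lborel_has_bochner_integral_real_affine_iff[where c=1 and t="- ln c"]) simp_all
  then have "has_bochner_integral lborel
      (\<lambda>s::real. of_real c * exp (of_real s - of_real (c * exp s))) (1 :: complex)"
  proof (rule has_bochner_integral_cong[OF refl _ refl, THEN iffD1, rotated])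
    fix s :: real
    have c: "exp (complex_of_real (ln c)) = of_real c"
      using assms by (simp add: exp_of_real)
    show "exp (of_real (ln c + 1 * s) - of_real (exp (ln c + 1 * s)))
        = complex_of_real c * exp (of_real s - of_real (c * exp s))"
      using assms by (simp add: exp_add exp_diff c)
  qed
  then have "has_bochner_integral lborel
      (\<lambda>s::real. (1 / of_real c) * (of_real c * exp (of_real s - of_real (c * exp s)))) (1 / of_real c * 1 :: complex)"
    by (rule has_bochner_integral_mult_right[rotated])
  then show ?thesis
    using assms by simp
qed

text \<open>Substituting \<open>r = s + q\<close> in \<open>\<Gamma>(1 - w) \<Gamma>(w) = \<integral>\<integral> exp ((1 - w) s - e\<^sup>s) exp (w r - e\<^sup>r) ds dr\<close>
  makes the integral over \<open>s\<close> elementary.\<close>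
lemma has_bochner_integral_exp_over_1_plus_exp:
  fixes w :: complex
  assumes "0 < Re w" "Re w < 1"
  shows "has_bochner_integral lborel (\<lambda>q::real. exp (w * of_real q) / of_real (1 + exp q))
    (of_real pi / sin (of_real pi * w))"
proof -
  define f :: "real \<Rightarrow> complex" where "f s = exp ((1 - w) * of_real s - of_real (exp s))" for s
  define g :: "real \<Rightarrow> complex" where "g s = exp (w * of_real s - of_real (exp s))" for s
  have f: "has_bochner_integral lborel f (Gamma (1 - w))"
    and g: "has_bochner_integral lborel g (Gamma w)"
    unfolding f_def[abs_def] g_def[abs_def]
    using assms by (auto intro!: has_bochner_integral_Gamma_exp)
  have "(\<integral>s. f s * g (q + s) \<partial>lborel) = exp (w * of_real q) / of_real (1 + exp q)" for q
  proof -
    \<comment> \<open>The exponents add up to \<open>(1 - w) * s + w * (q + s) = s + w * q\<close>,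
      so \<open>w\<close> leaves the integral over \<open>s\<close>.\<close>
    have "f s * g (q + s) = exp (w * of_real q) * exp (of_real s - of_real ((1 + exp q) * exp s))" for s
      unfolding f_def g_def exp_add[symmetric]
      by (simp add: algebra_simps exp_add)
    then have "(\<integral>s. f s * g (q + s) \<partial>lborel)
        = exp (w * of_real q) * (\<integral>s. exp (of_real s - of_real ((1 + exp q) * exp s)) \<partial>lborel)"
      by (simp del: of_real_add of_real_mult)
    also have "(\<integral>s. exp (of_real s - of_real ((1 + exp q) * exp s)) \<partial>lborel) = (1 / of_real (1 + exp q) :: complex)"
      by (intro has_bochner_integral_integral_eq has_bochner_integral_exp_minus_exp)
        (simp add: add_pos_pos)
    finally show ?thesis by simp
  qed
  then have "has_bochner_integral lborel (\<lambda>q::real. exp (w * of_real q) / of_real (1 + exp q))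
      (Gamma (1 - w) * Gamma w)"
    using has_bochner_integral_convolution[of f g] f g
    by (simp add: has_bochner_integral_iff)
  then show ?thesis
    by (simp only: Gamma_reflection_complex mult.commute[of "Gamma (1 - w)"])
qed

section \<open>The Fourier transform of the hyperbolic secant\<close>

definition sech_wave :: "real \<Rightarrow> real \<Rightarrow> complex"
  where "sech_wave c s = cis (c * s) / of_real (cosh (sqrt pi * s))"

text \<open>With \<open>u = sqrt pi * s\<close>, the identity
  \<open>1 + exp (2 * u) = 2 * exp u * cosh u\<close> turns the integrand of the reflection integral
  at \<open>q = 2 * u\<close> into half a \<open>sech_wave\<close>. On the line
  \<open>Re w = 1/2\<close> the sine in its value becomes a hyperbolic cosine.\<close>

lemma has_bochner_integral_sech_wave:
  "has_bochner_integral lborel (sech_wave c) (of_real (sqrt pi / cosh (sqrt pi * c / 2)))"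
proof -
  \<comment> \<open>Chosen so that for \<open>q = 2 * sqrt pi * s\<close> the phase
    \<open>\<tau> * q\<close> equals \<open>c * s\<close>, while the real part \<open>1 / 2\<close>
    of \<open>w\<close> contributes \<open>exp (sqrt pi * s)\<close>.\<close>
  define \<tau> where "\<tau> = c / (2 * sqrt pi)"
  define w where "w = Complex (1 / 2) \<tau>"
  have sp: "sqrt pi * sqrt pi = pi" by simp
  have "of_real pi * w = of_real (pi / 2) + \<i> * of_real (pi * \<tau>)"
    by (simp add: w_def complex_eq_iff)
  then have "sin (of_real pi * w) = cos (\<i> * of_real (pi * \<tau>))"
    by (simp add: sin_add del: of_real_mult of_real_divide add: cos_of_real sin_of_real)
  also have "\<dots> = of_real (cosh (pi * \<tau>))"
    by (simp only: cosh_conv_cos[symmetric] cosh_field_def exp_of_real cosh_def scaleR_conv_of_real)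
      (simp add: exp_of_real[symmetric] cosh_def)
  also have "pi * \<tau> = sqrt pi * c / 2"
    using sp by (simp add: \<tau>_def field_simps)
  finally have sin: "sin (of_real pi * w) = of_real (cosh (sqrt pi * c / 2))" .
  have "has_bochner_integral lborel (\<lambda>q::real. exp (w * of_real q) / of_real (1 + exp q))
      (of_real pi / of_real (cosh (sqrt pi * c / 2)))"
    using has_bochner_integral_exp_over_1_plus_exp[of w] by (simp add: sin) (simp add: w_def)
  then have "has_bochner_integral lborel
      (\<lambda>s. exp (w * of_real (0 + 2 * sqrt pi * s)) / of_real (1 + exp (0 + 2 * sqrt pi * s)))
      ((of_real pi / of_real (cosh (sqrt pi * c / 2))) /\<^sub>R \<bar>2 * sqrt pi\<bar>)"
    by (subst (asm) lborel_has_bochner_integral_real_affine_iff[where c="2 * sqrt pi" and t=0]) simp_all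
  also have "(\<lambda>s. exp (w * of_real (0 + 2 * sqrt pi * s)) / of_real (1 + exp (0 + 2 * sqrt pi * s)))
      = (\<lambda>s. sech_wave c s / 2)"
  proof
    fix s
    have "w * of_real (0 + 2 * sqrt pi * s) = of_real (sqrt pi * s) + \<i> * of_real (c * s)"
      by (simp add: w_def \<tau>_def complex_eq_iff field_simps)
    then have 1: "exp (w * of_real (0 + 2 * sqrt pi * s)) = of_real (exp (sqrt pi * s)) * cis (c * s)"
      by (simp add: exp_add cis_conv_exp exp_of_real[symmetric] del: of_real_mult)
    have "exp (2 * (sqrt pi * s)) = exp (sqrt pi * s) ^ 2"
      by (rule exp_double)
    then have 2: "1 + exp (0 + 2 * sqrt pi * s) = 2 * exp (sqrt pi * s) * cosh (sqrt pi * s)"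
      by (simp add: cosh_def algebra_simps power2_eq_square exp_minus)
    show "exp (w * of_real (0 + 2 * sqrt pi * s)) / of_real (1 + exp (0 + 2 * sqrt pi * s))
        = sech_wave c s / 2"
      unfolding 1 2 sech_wave_def by simp
  qed
  finally have "has_bochner_integral lborel (\<lambda>s. 2 * (sech_wave c s / 2))
      (2 * ((of_real pi / of_real (cosh (sqrt pi * c / 2))) /\<^sub>R \<bar>2 * sqrt pi\<bar>))"
    by (rule has_bochner_integral_mult_right[rotated])
  moreover have "2 * ((of_real pi / of_real (cosh (sqrt pi * c / 2))) /\<^sub>R \<bar>2 * sqrt pi\<bar>)
      = complex_of_real (2 * (pi / cosh (sqrt pi * c / 2) / (2 * sqrt pi)))"
    by (simp add: scaleR_conv_of_real divide_simps)
  moreover have "2 * (pi / cosh (sqrt pi * c / 2) / (2 * sqrt pi)) = sqrt pi / cosh (sqrt pi * c / 2)"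
    using sp by (simp add: divide_simps)
  ultimately show ?thesis
    by (simp only: nonzero_mult_div_cancel_left times_divide_eq_right) simp
qed

section \<open>Folding the line onto a half-line\<close>

text \<open>Reflection maps the negative half-line to \<open>{0<..}\<close>, which differs from
  \<open>{0..}\<close> by a null set.\<close>

lemma integral_lborel_fold:
  fixes f :: "real \<Rightarrow> complex"
  assumes f: "integrable lborel f"
  shows "(\<integral>x. f x \<partial>lborel) = (LBINT x:{0..}. f x + f (- x))"
proof -
  have [measurable]: "f \<in> borel_measurable borel" using f by auto
  have f': "integrable lborel (\<lambda>x. f (- x))"
    using lborel_integrable_real_affine[OF f, of "-1" 0] by simp
  have i: "set_integrable lborel A f" "set_integrable lborel A (\<lambda>x. f (- x))"
    if "A \<in> sets lborel" for A
    using f f' that unfolding set_integrable_def by (auto intro: integrable_mult_indicator)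
  have "(\<integral>x. f x \<partial>lborel) = (\<integral>x. indicator {0..} x *\<^sub>R f x + indicator {..<0} x *\<^sub>R f x \<partial>lborel)"
    by (intro Bochner_Integration.integral_cong) (auto simp: indicator_def)
  also have "\<dots> = (LBINT x:{0..}. f x) + (LBINT x:{..<0}. f x)"
    unfolding set_lebesgue_integral_def
    using i[of "{0..}"] i[of "{..<0}"] unfolding set_integrable_def
    by (intro Bochner_Integration.integral_add) auto
  also have "(LBINT x:{..<0}. f x) = (\<integral>x. indicator {0<..} x *\<^sub>R f (- x) \<partial>lborel)"
    unfolding set_lebesgue_integral_def
    by (subst lborel_integral_real_affine[where c="-1" and t=0])
      (auto intro!: Bochner_Integration.integral_cong simp: indicator_def)
  also have "\<dots> = (LBINT x:{0..}. f (- x))"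
    unfolding set_lebesgue_integral_def
  proof (rule integral_cong_AE)
    show "AE x in lborel. indicator {0<..} x *\<^sub>R f (- x) = indicator {0..} x *\<^sub>R f (- x)"
      using AE_lborel_singleton[of "0::real"] by eventually_elim (auto simp: indicator_def)
  qed measurable
  also have "(LBINT x:{0..}. f x) + (LBINT x:{0..}. f (- x)) = (LBINT x:{0..}. f x + f (- x))"
    using i[of "{0..}"] by (simp add: set_integral_add)
  finally show ?thesis .
qed

section \<open>Integrability of the kernel\<close>

text \<open>Since \<open>cosh x \<ge> 1\<close>, the double-angle formula bounds
  \<open>cosh (x / 2) ^ 2\<close> by \<open>cosh x\<close>, and
  \<open>2 * p * q \<le> p ^ 2 + q ^ 2\<close> does the rest. The bound is lossy, but it dominates
  the kernel by a product of functions of one variable.\<close>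

lemma cosh_half_mult_le:
  fixes u v :: real
  shows "cosh (u / 2) * cosh (v / 2) \<le> cosh u + cosh v"
proof -
  have half: "cosh (x / 2) ^ 2 \<le> cosh x" for x :: real
    using cosh_double_cosh[of "x / 2"] cosh_real_ge_1[of x] by simp
  have "2 * (cosh (u / 2) * cosh (v / 2)) \<le> cosh (u / 2) ^ 2 + cosh (v / 2) ^ 2"
    using sum_squares_bound[of "cosh (u / 2)" "cosh (v / 2)"] by simp
  also have "\<dots> \<le> cosh u + cosh v"
    using half by (intro add_mono)
  finally show ?thesis
    using cosh_real_ge_1[of u] cosh_real_ge_1[of v] by linarith
qed

definition cosh_kernel :: "real \<Rightarrow> real \<Rightarrow> real"
  where "cosh_kernel x y = 1 / (cosh (sqrt pi * x) + cosh (sqrt pi * y))"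

lemma cosh_kernel_pos: "cosh_kernel x y > 0"
  by (simp add: cosh_kernel_def add_pos_pos)

lemma cosh_kernel_minus [simp]: "cosh_kernel (- x) y = cosh_kernel x y" "cosh_kernel x (- y) = cosh_kernel x y"
  by (simp_all add: cosh_kernel_def)

lemma cosh_kernel_measurable [measurable]:
  "(\<lambda>p. cosh_kernel (fst p) (snd p)) \<in> borel_measurable (borel \<Otimes>\<^sub>M borel)"
  "cosh_kernel x \<in> borel_measurable borel" "(\<lambda>x. cosh_kernel x y) \<in> borel_measurable borel"
proof -
  have [simp]: "cosh s + cosh t \<noteq> 0" for s t :: real
    using cosh_real_pos[of s] cosh_real_pos[of t] by linarith
  have "continuous_on UNIV (\<lambda>p. cosh_kernel (fst p) (snd p))" "continuous_on UNIV (cosh_kernel x)"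
    "continuous_on UNIV (\<lambda>x. cosh_kernel x y)"
    unfolding cosh_kernel_def[abs_def] by (auto intro!: continuous_intros)
  then show "(\<lambda>p. cosh_kernel (fst p) (snd p)) \<in> borel_measurable (borel \<Otimes>\<^sub>M borel)"
    "cosh_kernel x \<in> borel_measurable borel" "(\<lambda>x. cosh_kernel x y) \<in> borel_measurable borel"
    unfolding borel_prod by (auto intro: borel_measurable_continuous_onI)
qed

lemma integrable_sech: "integrable lborel (\<lambda>x. 1 / cosh (sqrt pi * x / 2))"
proof -
  have "integrable lborel (\<lambda>s. 1 / cosh (sqrt pi * s))"
    using has_bochner_integral_sech_wave[of 0, THEN integrable.intros, THEN integrable_norm]
    by (simp add: sech_wave_def[abs_def] norm_divide)
  from lborel_integrable_real_affine[OF this, of "1/2" 0] show ?thesis by simp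
qed

lemma cosh_kernel_le: "cosh_kernel x y \<le> 1 / cosh (sqrt pi * x / 2) * (1 / cosh (sqrt pi * y / 2))"
  using cosh_half_mult_le[of "sqrt pi * x" "sqrt pi * y"]
  by (simp add: cosh_kernel_def frac_le)

text \<open>The phases have modulus one, so the product of two hyperbolic secants that dominates the
  kernel dominates the integrands too. The one-variable version justifies folding the inner integral
  for every \<open>y\<close>.\<close>

lemma integrable_kernel_wave:
  "integrable (lborel \<Otimes>\<^sub>M lborel) (\<lambda>(x, y). cis (a * x) * cis (b * y) * of_real (cosh_kernel x y))"
  "integrable lborel (\<lambda>x. cis (a * x) * of_real (cosh_kernel x y))"
proof -
  have cis: "(\<lambda>x. cis (c * x)) \<in> borel_measurable borel" for c
    by (intro borel_measurable_continuous_onI continuous_intros)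
  note [measurable] = cis[of a] cis[of b]
  let ?h = "\<lambda>x. 1 / cosh (sqrt pi * x / 2)"
  have "integrable (lborel \<Otimes>\<^sub>M lborel) (\<lambda>(x, y). ?h x * ?h y)"
  proof (rule lborel_pair.Fubini_integrable)
    have [measurable]: "?h \<in> borel_measurable borel" using integrable_sech by auto
    show "(\<lambda>(x, y). ?h x * ?h y) \<in> borel_measurable (lborel \<Otimes>\<^sub>M lborel)" by measurable
  qed (use integrable_sech in \<open>auto simp: abs_mult simp del: times_divide_eq_left times_divide_eq_right\<close>)
  then show "integrable (lborel \<Otimes>\<^sub>M lborel) (\<lambda>(x, y). cis (a * x) * cis (b * y) * of_real (cosh_kernel x y))"
  proof (rule Bochner_Integration.integrable_bound)
    show "(\<lambda>(x, y). cis (a * x) * cis (b * y) * of_real (cosh_kernel x y)) \<in> borel_measurable (lborel \<Otimes>\<^sub>M lborel)"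
      unfolding case_prod_beta by measurable
    show "AE p in lborel \<Otimes>\<^sub>M lborel. norm (case p of (x, y) \<Rightarrow> cis (a * x) * cis (b * y) * of_real (cosh_kernel x y))
        \<le> norm (case p of (x, y) \<Rightarrow> ?h x * ?h y)"
      using cosh_kernel_le cosh_kernel_pos by (auto simp: norm_mult less_imp_le)
  qed
  have "integrable lborel (\<lambda>x. ?h x * ?h y)"
    by (rule integrable_mult_left) (rule integrable_sech)
  then show "integrable lborel (\<lambda>x. cis (a * x) * of_real (cosh_kernel x y))"
  proof (rule Bochner_Integration.integrable_bound)
    show "AE x in lborel. norm (cis (a * x) * of_real (cosh_kernel x y)) \<le> norm (?h x * ?h y)"
      using cosh_kernel_le cosh_kernel_pos by (auto simp: norm_mult less_imp_le)
  qed measurable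
qed

section \<open>The integral over the plane\<close>

lemma cosh_add_cosh:
  fixes s t :: real
  shows "cosh (s + t) + cosh (s - t) = 2 * cosh s * cosh t"
  by (simp add: cosh_add cosh_diff)

text \<open>In the coordinates \<open>x = s + t\<close>, \<open>y = s - t\<close> the kernel is a product of two hyperbolic secants.\<close>
lemma has_bochner_integral_kernel_wave:
  "has_bochner_integral lborel (\<lambda>y. \<integral>x. cis (a * x) * cis (b * y) * of_real (cosh_kernel x y) \<partial>lborel)
    (of_real (2 * pi * cosh_kernel a b))"
proof -
  have inner: "(\<integral>x. cis (a * x) * cis (b * y) * of_real (cosh_kernel x y) \<partial>lborel)
      = (\<integral>t. sech_wave (a - b) t * sech_wave (a + b) (y + t) \<partial>lborel)" for y
  proof -
    \<comment> \<open>For fixed \<open>y\<close> put \<open>x = y + 2 * t\<close>, so that half the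
      sum and half the difference of \<open>x\<close> and \<open>y\<close> are \<open>y + t\<close>
      and \<open>t\<close>. The Jacobian 2 cancels the factor 2 from
      \<open>cosh_add_cosh\<close>.\<close>
    have eq: "2 *\<^sub>R (cis (a * (y + 2 * t)) * cis (b * y) * of_real (cosh_kernel (y + 2 * t) y))
        = sech_wave (a - b) t * sech_wave (a + b) (y + t)" for t
    proof -
      have "cosh (sqrt pi * (y + 2 * t)) + cosh (sqrt pi * y)
          = 2 * cosh (sqrt pi * (y + t)) * cosh (sqrt pi * t)"
        using cosh_add_cosh[of "sqrt pi * (y + t)" "sqrt pi * t"] by (simp add: algebra_simps)
      moreover have "cis (a * (y + 2 * t)) * cis (b * y) = cis ((a - b) * t) * cis ((a + b) * (y + t))"
        unfolding cis_mult by (simp add: algebra_simps)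
      ultimately show ?thesis
        by (simp add: cosh_kernel_def sech_wave_def scaleR_conv_of_real)
    qed
    show ?thesis
      by (subst lborel_integral_real_affine[where c=2 and t=y])
        (simp_all add: eq[symmetric] scaleR_conv_of_real)
  qed
  \<comment> \<open>The sum-to-product formula, now read backwards in the frequencies, reassembles
    the same kernel at \<open>(a, b)\<close>.\<close>
  have "sqrt pi / cosh (sqrt pi * (a - b) / 2) * (sqrt pi / cosh (sqrt pi * (a + b) / 2))
      = pi / (cosh (sqrt pi * (a - b) / 2) * cosh (sqrt pi * (a + b) / 2))"
    by simp
  also have "\<dots> = 2 * pi * cosh_kernel a b"
    using cosh_add_cosh[of "sqrt pi * (a + b) / 2" "sqrt pi * (a - b) / 2"]
    unfolding cosh_kernel_def by (simp add: field_simps)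
  finally have split: "sqrt pi / cosh (sqrt pi * (a - b) / 2) * (sqrt pi / cosh (sqrt pi * (a + b) / 2))
      = 2 * pi * cosh_kernel a b" .
  have "has_bochner_integral lborel
      (\<lambda>y. \<integral>t. sech_wave (a - b) t * sech_wave (a + b) (y + t) \<partial>lborel)
      (of_real (sqrt pi / cosh (sqrt pi * (a - b) / 2)) * of_real (sqrt pi / cosh (sqrt pi * (a + b) / 2)))"
    using has_bochner_integral_convolution[OF integrable.intros integrable.intros,
        OF has_bochner_integral_sech_wave has_bochner_integral_sech_wave, of "a - b" "a + b"]
    unfolding has_bochner_integral_integral_eq[OF has_bochner_integral_sech_wave] .
  then show ?thesis
    unfolding inner of_real_mult[symmetric] split .
qed

section \<open>The integral over the quadrant\<close>

theorem mainTheorem5: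
  fixes a b :: real
  shows "set_integrable lborel ({0..} \<times> {0..})
           (\<lambda>(x::real, y::real). cos (a * x) * cos (b * y) / (cosh (sqrt pi * x) + cosh (sqrt pi * y)))
       \<and> 2 / pi * (LBINT y:{0..}. (LBINT x:{0..}.
             cos (a * x) * cos (b * y) / (cosh (sqrt pi * x) + cosh (sqrt pi * y))))
         = 1 / (cosh (sqrt pi * a) + cosh (sqrt pi * b))"
proof
  \<comment> \<open>At frequencies zero both phases are 1, which leaves the bare kernel as a
    dominating function.\<close>
  have "integrable lborel (\<lambda>(x, y). complex_of_real (cosh_kernel x y))"
    using integrable_kernel_wave(1)[of 0 0] by (simp add: lborel_prod)
  then have dom: "integrable lborel (\<lambda>p. indicator ({0..} \<times> {0..}) p *\<^sub>R (case p of (x, y) \<Rightarrow> complex_of_real (cosh_kernel x y)))"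
    by (intro integrable_mult_indicator) (auto simp: borel_Times)
  show "set_integrable lborel ({0..} \<times> {0..})
      (\<lambda>(x::real, y::real). cos (a * x) * cos (b * y) / (cosh (sqrt pi * x) + cosh (sqrt pi * y)))"
    unfolding set_integrable_def
  proof (rule Bochner_Integration.integrable_bound[OF dom])
    have [simp]: "cosh s + cosh t \<noteq> 0" for s t :: real
      using cosh_real_pos[of s] cosh_real_pos[of t] by linarith
    have "continuous_on UNIV
        (\<lambda>(x::real, y::real). cos (a * x) * cos (b * y) / (cosh (sqrt pi * x) + cosh (sqrt pi * y)))"
      unfolding case_prod_beta by (intro continuous_intros) simp
    then show "(\<lambda>p. indicator ({0..} \<times> {0..}) p *\<^sub>R
        (case p of (x, y) \<Rightarrow> cos (a * x) * cos (b * y) / (cosh (sqrt pi * x) + cosh (sqrt pi * y))))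
        \<in> borel_measurable lborel"
      by (intro borel_measurable_scaleR borel_measurable_indicator)
        (auto simp: borel_Times intro: borel_measurable_continuous_onI)
    have "\<bar>cos (a * x) * cos (b * y) / (cosh (sqrt pi * x) + cosh (sqrt pi * y))\<bar> \<le> \<bar>cosh_kernel x y\<bar>" for x y
    proof -
      have "\<bar>cos (a * x) * cos (b * y)\<bar> \<le> 1"
        unfolding abs_mult by (rule mult_le_one) auto
      then show ?thesis
        unfolding cosh_kernel_def abs_divide by (simp add: divide_right_mono)
    qed
    then show "AE p in lborel. norm (indicator ({0..} \<times> {0..}) p *\<^sub>R
        (case p of (x, y) \<Rightarrow> cos (a * x) * cos (b * y) / (cosh (sqrt pi * x) + cosh (sqrt pi * y))))
        \<le> norm (indicator ({0..} \<times> {0..}) p *\<^sub>R (case p of (x, y) \<Rightarrow> complex_of_real (cosh_kernel x y)))"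
      by (auto simp: indicator_def)
  qed
next
  \<comment> \<open>The plane is folded one variable at a time; \<open>R\<close> is what the fold in
    \<open>x\<close> leaves, up to a factor 2. The phase in \<open>y\<close> stays complex until the
    second fold.\<close>
  define R where "R y = (LBINT x:{0..}. cos (a * x) * cosh_kernel x y)" for y
  have cis_add: "cis t + cis (- t) = of_real (2 * cos t)" for t
    by (simp add: complex_eq_iff)
  have inner: "(\<integral>x. cis (a * x) * cis (b * y) * of_real (cosh_kernel x y) \<partial>lborel)
      = cis (b * y) * of_real (2 * R y)" for y
  proof -
    have "(\<integral>x. cis (a * x) * cis (b * y) * of_real (cosh_kernel x y) \<partial>lborel)
        = cis (b * y) * (\<integral>x. cis (a * x) * of_real (cosh_kernel x y) \<partial>lborel)"
      by (subst integral_mult_right_zero[symmetric]) (simp add: ac_simps)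
    also have "(\<integral>x. cis (a * x) * of_real (cosh_kernel x y) \<partial>lborel)
        = (LBINT x:{0..}. of_real (2 * (cos (a * x) * cosh_kernel x y)))"
      unfolding integral_lborel_fold[OF integrable_kernel_wave(2)]
      by (simp add: distrib_right[symmetric] cis_add mult.assoc)
    also have "\<dots> = of_real (2 * R y)"
      unfolding R_def set_integral_complex_of_real by simp
    finally show ?thesis .
  qed
  have R_even: "R (- y) = R y" for y
    by (simp add: R_def)
  have "of_real (2 * pi * cosh_kernel a b) = (\<integral>y. cis (b * y) * of_real (2 * R y) \<partial>lborel)"
    using has_bochner_integral_kernel_wave[of a b]
    by (simp add: inner has_bochner_integral_iff)
  \<comment> \<open>As \<open>R\<close> is even, the two phases in \<open>y\<close> now combine to a
    cosine; each fold has contributed a factor 2, giving 4 for the four quadrants.\<close>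
  also have "\<dots> = (LBINT y:{0..}. cis (b * y) * of_real (2 * R y) + cis (b * - y) * of_real (2 * R (- y)))"
    using has_bochner_integral_kernel_wave[of a b]
    by (intro integral_lborel_fold) (simp add: inner has_bochner_integral_iff)
  also have "\<dots> = (LBINT y:{0..}. of_real (4 * (cos (b * y) * R y)))"
    unfolding R_even distrib_right[symmetric] by (simp add: cis_add mult.assoc)
  also have "\<dots> = of_real (4 * (LBINT y:{0..}. cos (b * y) * R y))"
    unfolding set_integral_complex_of_real by simp
  finally have "2 * pi * cosh_kernel a b = 4 * (LBINT y:{0..}. cos (b * y) * R y)"
    by (simp only: of_real_eq_iff)
  then have "1 / (cosh (sqrt pi * a) + cosh (sqrt pi * b)) = 2 / pi * (LBINT y:{0..}. cos (b * y) * R y)"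
    unfolding cosh_kernel_def[symmetric] by (simp add: field_simps)
  moreover have "cos (b * y) * R y
      = (LBINT x:{0..}. cos (a * x) * cos (b * y) / (cosh (sqrt pi * x) + cosh (sqrt pi * y)))" for y
  proof -
    have "cos (a * x) * cos (b * y) / (cosh (sqrt pi * x) + cosh (sqrt pi * y)) = cos (b * y) * (cos (a * x) * cosh_kernel x y)" for x
      by (simp add: cosh_kernel_def)
    then show ?thesis
      by (simp only: R_def set_integral_mult_right)
  qed
  ultimately show "2 / pi * (LBINT y:{0..}. (LBINT x:{0..}.
        cos (a * x) * cos (b * y) / (cosh (sqrt pi * x) + cosh (sqrt pi * y))))
      = 1 / (cosh (sqrt pi * a) + cosh (sqrt pi * b))"
    by simp
qed

end
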